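(* Let $M$ be a threat model, i.e. a set of transformations $T:\mathcal P\to\mathcal P$ of the set of programs $\mathcal P$, and let $\phi:\mathcal P\to\mathbb R^k$ be a feature mapping such that the set of perturbation vectors $\Delta_M=\{\phi(T(P))-\phi(P)\mid T\in M,\ P\in\mathcal P\}$ is finite. Let $L'\circ L:\mathbb R^k\to\mathbb R$ be an ERDALT model trained with knowledge of $\Delta_M$, that is: $L:\mathbb R^k\to\mathbb R^d$ is a linear map (no bias, no activation) satisfying $L(\delta)\ge0$ componentwise for every $\delta\in\Delta_M$, and $L':\mathbb R^d\to\mathbb R$ is monotonically increasing, i.e. $v_1\le v_2$ componentwise implies $L'(v_1)\le L'(v_2)$. Then the classifier $L'\circ L$ (with any decision threshold $\tau\in\mathbb R$) is robust against adversarial attacks for the threat model $M$.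
   Context: $\mathcal P$ is the set of programs (executable binaries; an arbitrary set for the purposes of the statement). For a set $M$ of transformations of programs, the preorder $\preceq_M$ on $\mathcal P$ is defined by: $P\preceq_M P'$ if $P$ can be transformed into $P'$ using transformations available in $M$, i.e. $P'=(T_n\circ\cdots\circ T_1)(P)$ for some finite (possibly empty) sequence $T_1,\dots,T_n\in M$. A classifier $f:\mathbb R^k\to\mathbb R$ with feature mapping $\phi$ and decision threshold $\tau\in\mathbb R$ is said to be robust against adversarial attacks for $M$ if for all programs $P,P'$ with $P\preceq_M P'$, $f(\phi(P))\ge\tau\Longrightarrow f(\phi(P'))\ge\tau$. ERDALT ("Empirically Robust by Design with Adversarial Linear Transformation") is a model architecture $L'\circ L$ consisting of a linear first layer $L$, without bias or activation function, constrained to have non-negative output on the perturbation vectors known during training, followed by upper layers $L'$ forming a monotonic classifier. *)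

theory Defs
  imports "HOL-Analysis.Analysis"
begin

text \<open>
  The set of programs is the type \<open>'p\<close>. With \<open>Ts = [T\<^sub>1, \<dots>, T\<^sub>n]\<close>, the term
  \<open>fold (\<lambda>T. T) Ts\<close> is the composition \<open>T\<^sub>n \<circ> \<dots> \<circ> T\<^sub>1\<close>; the empty list gives the identity.
\<close>

definition transformable :: "('p \<Rightarrow> 'p) set \<Rightarrow> 'p \<Rightarrow> 'p \<Rightarrow> bool" where
  "transformable M P P' \<longleftrightarrow> (\<exists>Ts. set Ts \<subseteq> M \<and> P' = fold (\<lambda>T. T) Ts P)"

definition perturbation_vectors :: "('p \<Rightarrow> 'p) set \<Rightarrow> ('p \<Rightarrow> real ^ 'k) \<Rightarrow> (real ^ 'k) set" where
  "perturbation_vectors M \<phi> = {\<phi> (T P) - \<phi> P | T P. T \<in> M}"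

definition robust ::
    "('p \<Rightarrow> 'p) set \<Rightarrow> ('p \<Rightarrow> real ^ 'k) \<Rightarrow> (real ^ 'k \<Rightarrow> real) \<Rightarrow> real \<Rightarrow> bool" where
  "robust M \<phi> f \<tau> \<longleftrightarrow>
     (\<forall>P P'. transformable M P P' \<longrightarrow> f (\<phi> P) \<ge> \<tau> \<longrightarrow> f (\<phi> P') \<ge> \<tau>)"

text \<open>The order on \<open>real ^ 'd\<close>, which \<open>\<le>\<close> and \<open>mono\<close> refer to here, is the componentwise one.\<close>

definition erdalt ::
    "(real ^ 'k) set \<Rightarrow> (real ^ 'k \<Rightarrow> real ^ 'd) \<Rightarrow> (real ^ 'd \<Rightarrow> real) \<Rightarrow> bool" where
  "erdalt \<Delta> L L' \<longleftrightarrow> linear L \<and> (\<forall>\<delta>\<in>\<Delta>. 0 \<le> L \<delta>) \<and> mono L'"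

end

theory Submission
  imports Defs
begin

text \<open>By linearity, one transformation changes the first layer's output by \<open>L\<close> of
  a perturbation vector, hence by a componentwise nonnegative amount, whatever program it is applied
  to (\<open>erdalt_step\<close>). Chaining this along a sequence (\<open>erdalt_fold\<close>) and
  applying the monotone \<open>L'\<close> shows that the score never decreases, so no threshold can
  be crossed downwards.\<close>

lemma erdalt_step:
  assumes "erdalt (perturbation_vectors M \<phi>) L L'" "T \<in> M"
  shows "L (\<phi> P) \<le> L (\<phi> (T P))"
proof -
  have "\<phi> (T P) - \<phi> P \<in> perturbation_vectors M \<phi>"
    using assms(2) by (auto simp: perturbation_vectors_def)
  then have "0 \<le> L (\<phi> (T P) - \<phi> P)"
    using assms(1) by (auto simp: erdalt_def)
  also have "\<dots> = L (\<phi> (T P)) - L (\<phi> P)"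
    using assms(1) by (simp add: erdalt_def linear_diff)
  \<comment> \<open>The order is componentwise, so the difference is rearranged in each real
    coordinate.\<close>
  finally show ?thesis
    by (simp add: less_eq_vec_def)
qed

lemma erdalt_fold:
  assumes "erdalt (perturbation_vectors M \<phi>) L L'" "set Ts \<subseteq> M"
  shows "L (\<phi> P) \<le> L (\<phi> (fold (\<lambda>T. T) Ts P))"
  using assms(2)
proof (induction Ts arbitrary: P)
  case Nil
  show ?case by simp
next
  case (Cons T Ts)
  have "L (\<phi> P) \<le> L (\<phi> (T P))"
    using erdalt_step[OF assms(1)] Cons.prems by simp
  \<comment> \<open>\<open>fold\<close> applies the head first, so the induction hypothesis is used
    at \<open>T P\<close>; hence \<open>P\<close> is kept arbitrary.\<close>
  also have "\<dots> \<le> L (\<phi> (fold (\<lambda>T. T) Ts (T P)))"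
    using Cons by simp
  finally show ?case by simp
qed

theorem proposition3:
  fixes M :: "('p \<Rightarrow> 'p) set"
    and \<phi> :: "'p \<Rightarrow> real ^ 'k"
    and L :: "real ^ 'k \<Rightarrow> real ^ 'd"
    and L' :: "real ^ 'd \<Rightarrow> real"
    and \<tau> :: real
  assumes "finite (perturbation_vectors M \<phi>)"
    and "erdalt (perturbation_vectors M \<phi>) L L'"
  shows "robust M \<phi> (L' \<circ> L) \<tau>"
  unfolding robust_def
proof (intro allI impI)
  fix P P'
  assume "transformable M P P'" and P: "\<tau> \<le> (L' \<circ> L) (\<phi> P)"
  then have "L (\<phi> P) \<le> L (\<phi> P')"
    using erdalt_fold[OF assms(2)] by (auto simp: transformable_def)
  moreover have "mono L'"
    using assms(2) by (simp add: erdalt_def)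
  ultimately have "L' (L (\<phi> P)) \<le> L' (L (\<phi> P'))"
    by (simp add: monoD)
  then show "\<tau> \<le> (L' \<circ> L) (\<phi> P')"
    using P by simp
qed

end
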